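(* The finite Hilbert transform $T_{\log}\colon L\log L\to L^1$ is not completely continuous.
   Context: $\mu$ is Lebesgue measure on the Borel $\sigma$-algebra $\mathcal B$ of $(-1,1)$, $L^0$ is the space of (a.e.-equivalence classes of) $\mathbb C$-valued measurable functions on $(-1,1)$, and $L^1=L^1(\mu)$. The finite Hilbert transform of $f\in L^1$ is $T(f)(t):=\lim_{\varepsilon\to0^+}\frac1\pi\left(\int_{-1}^{t-\varepsilon}+\int_{t+\varepsilon}^1\right)\frac{f(x)}{x-t}\,dx$, which exists for a.e. $t\in(-1,1)$ and is measurable. For $f\in L^0$, $f^*$ is the decreasing rearrangement (the right-continuous inverse of the distribution function $\lambda\mapsto\mu(\{|f|>\lambda\})$). $L\log L$ is the space of all $f\in L^0$ with $\|f\|_{L\log L}:=\int_0^2 f^*(t)\log(2e/t)\,dt<\infty$, equipped with this norm (equivalently, $\int_{-1}^1|f|\log^+|f|\,dx<\infty$). It is known that $T$ maps $L\log L$ boundedly into $L^1$; $T_{\log}\colon L\log L\to L^1$ denotes the resulting operator. A linear operator between Banach spaces is completely continuous if it maps every weakly compact set into a norm-compact set. *)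

theory Defs
  imports "HOL-Analysis.Analysis"
begin

text \<open>
  The distribution has no class of complex vector spaces, so a complex normed space is passed
  around as a scalar multiplication \<open>sc\<close> on an ambient additive group, a carrier \<open>V\<close> and
  a norm \<open>N\<close> on that carrier.
\<close>

definition norm_topology :: "'a::ab_group_add set \<Rightarrow> ('a \<Rightarrow> real) \<Rightarrow> 'a topology" where
  "norm_topology V N = Metric_space.mtopology V (\<lambda>x y. N (x - y))"

text \<open>Functionals are only constrained on \<open>V\<close>; their values elsewhere are arbitrary.\<close>

definition continuous_dual ::
  "(complex \<Rightarrow> 'a \<Rightarrow> 'a) \<Rightarrow> 'a::ab_group_add set \<Rightarrow> ('a \<Rightarrow> real) \<Rightarrow> ('a \<Rightarrow> complex) set" where
  "continuous_dual sc V N = {\<phi>.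
     (\<forall>x\<in>V. \<forall>y\<in>V. \<phi> (x + y) = \<phi> x + \<phi> y) \<and>
     (\<forall>c. \<forall>x\<in>V. \<phi> (sc c x) = c * \<phi> x) \<and>
     (\<exists>C. \<forall>x\<in>V. cmod (\<phi> x) \<le> C * N x)}"

definition weak_topology ::
  "(complex \<Rightarrow> 'a \<Rightarrow> 'a) \<Rightarrow> 'a::ab_group_add set \<Rightarrow> ('a \<Rightarrow> real) \<Rightarrow> 'a topology" where
  "weak_topology sc V N =
     topology_generated_by {{x \<in> V. \<phi> x \<in> U} |\<phi> U. \<phi> \<in> continuous_dual sc V N \<and> open U}"

definition completely_continuous ::
  "(complex \<Rightarrow> 'a \<Rightarrow> 'a) \<Rightarrow> 'a::ab_group_add set \<Rightarrow> ('a \<Rightarrow> real) \<Rightarrow>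
   'b::ab_group_add set \<Rightarrow> ('b \<Rightarrow> real) \<Rightarrow> ('a \<Rightarrow> 'b) \<Rightarrow> bool" where
  "completely_continuous sc V N W M T \<longleftrightarrow>
     (\<forall>K. compactin (weak_topology sc V N) K \<longrightarrow>
        (\<exists>C. compactin (norm_topology W M) C \<and> T ` K \<subseteq> C))"

abbreviation \<mu> :: "real measure" where
  "\<mu> \<equiv> restrict_space lborel {-1<..<1}"

definition ae_eq :: "(real \<Rightarrow> complex) \<Rightarrow> (real \<Rightarrow> complex) \<Rightarrow> bool" where
  "ae_eq f g \<longleftrightarrow> f \<in> borel_measurable \<mu> \<and> g \<in> borel_measurable \<mu> \<and> (AE x in \<mu>. f x = g x)"

quotient_type L0 = "real \<Rightarrow> complex" / partial: ae_eq
  morphisms rep_L0 abs_L0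
proof (rule part_equivpI)
  show "\<exists>f. ae_eq f f"
    by (rule exI[of _ "\<lambda>_. 0"]) (simp add: ae_eq_def)
  show "symp ae_eq"
    by (auto simp: symp_def ae_eq_def elim: AE_mp)
  show "transp ae_eq"
    unfolding transp_def ae_eq_def by (auto elim: AE_mp)
qed

instantiation L0 :: ab_group_add
begin

lift_definition zero_L0 :: L0 is "\<lambda>_. 0"
  by (simp add: ae_eq_def)

lift_definition plus_L0 :: "L0 \<Rightarrow> L0 \<Rightarrow> L0" is "\<lambda>f g x. f x + g x"
  unfolding ae_eq_def by (auto elim: AE_mp)

lift_definition uminus_L0 :: "L0 \<Rightarrow> L0" is "\<lambda>f x. - f x"
  unfolding ae_eq_def by (auto elim: AE_mp)

lift_definition minus_L0 :: "L0 \<Rightarrow> L0 \<Rightarrow> L0" is "\<lambda>f g x. f x - g x"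
  unfolding ae_eq_def by (auto elim: AE_mp)

instance
  by standard (transfer; auto simp: ae_eq_def algebra_simps)+

end

lift_definition scale_L0 :: "complex \<Rightarrow> L0 \<Rightarrow> L0" is "\<lambda>c f x. c * f x"
  unfolding ae_eq_def by (auto elim: AE_mp)

lift_definition enorm_L1 :: "L0 \<Rightarrow> ennreal" is "\<lambda>f. \<integral>\<^sup>+x. ennreal (cmod (f x)) \<partial>\<mu>"
  by (intro nn_integral_cong_AE) (auto simp: ae_eq_def elim: AE_mp)

definition L1 :: "L0 set" where
  "L1 = {f. enorm_L1 f < \<infinity>}"

definition norm_L1 :: "L0 \<Rightarrow> real" where
  "norm_L1 f = enn2real (enorm_L1 f)"

lift_definition distribution_function :: "L0 \<Rightarrow> real \<Rightarrow> real"
  is "\<lambda>f s. measure \<mu> {x \<in> space \<mu>. cmod (f x) > s}"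
proof -
  fix f g assume "ae_eq f g"
  then have [measurable]: "f \<in> borel_measurable \<mu>" "g \<in> borel_measurable \<mu>"
    and eq: "AE x in \<mu>. f x = g x"
    by (auto simp: ae_eq_def)
  show "(\<lambda>s. measure \<mu> {x \<in> space \<mu>. cmod (f x) > s}) =
        (\<lambda>s. measure \<mu> {x \<in> space \<mu>. cmod (g x) > s})"
  proof
    fix s
    show "measure \<mu> {x \<in> space \<mu>. cmod (f x) > s} =
          measure \<mu> {x \<in> space \<mu>. cmod (g x) > s}"
    proof (rule measure_eq_AE)
      show "AE x in \<mu>. x \<in> {x \<in> space \<mu>. cmod (f x) > s} \<longleftrightarrow>
              x \<in> {x \<in> space \<mu>. cmod (g x) > s}"
        using eq by eventually_elim auto
    qed measurable
  qed
qed

text \<open>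
  Only the values at \<open>0 < t\<close> are meaningful: there the set below is nonempty because \<open>\<mu>\<close> is
  finite, whereas at \<open>t = 0\<close> it is empty for essentially unbounded \<open>f\<close>.
\<close>

definition decreasing_rearrangement :: "L0 \<Rightarrow> real \<Rightarrow> real" where
  "decreasing_rearrangement f t = Inf {s. 0 \<le> s \<and> distribution_function f s \<le> t}"

definition enorm_LlogL :: "L0 \<Rightarrow> ennreal" where
  "enorm_LlogL f =
     (\<integral>\<^sup>+t\<in>{0<..<2}. ennreal (decreasing_rearrangement f t * ln (2 * exp 1 / t)) \<partial>lborel)"

definition LlogL :: "L0 set" where
  "LlogL = {f. enorm_LlogL f < \<infinity>}"

definition norm_LlogL :: "L0 \<Rightarrow> real" where
  "norm_LlogL f = enn2real (enorm_LlogL f)"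

definition truncated_hilbert :: "(real \<Rightarrow> complex) \<Rightarrow> real \<Rightarrow> real \<Rightarrow> complex" where
  "truncated_hilbert f \<epsilon> t =
     ((LBINT x:{-1<..<t - \<epsilon>}. f x / complex_of_real (x - t)) +
      (LBINT x:{t + \<epsilon><..<1}. f x / complex_of_real (x - t))) / complex_of_real pi"

text \<open>
  The integrals do not depend on the chosen representative of \<open>f\<close>. For \<open>f\<close> in \<open>L1\<close> the limit
  exists for almost every \<open>t\<close> in \<open>{-1<..<1}\<close>, and \<open>Lim\<close> takes one fixed value at the
  remaining points, so that the function passed to \<open>abs_L0\<close> is measurable.
\<close>

definition finite_hilbert_transform :: "L0 \<Rightarrow> L0" where
  "finite_hilbert_transform f =
     abs_L0 (\<lambda>t. Lim (at_right 0) (\<lambda>\<epsilon>. truncated_hilbert (rep_L0 f) \<epsilon> t))"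

definition T_log :: "L0 \<Rightarrow> L0" where
  "T_log = restrict finite_hilbert_transform LlogL"

end

theory Submission
  imports Defs
begin

text \<open>
  A completely continuous operator maps weakly convergent sequences to norm convergent ones, since a
  weakly convergent sequence together with its limit is weakly compact. The transform fails this on the
  functions \<open>f\<^sub>n x = sin (n * arccos x)\<close>, \<open>n \<ge> 1\<close>.

  The transform of \<open>f\<^sub>n\<close> is known in closed form: it is \<open>- cos (n * arccos t)\<close>, minus the Chebyshev
  polynomial of degree \<open>n\<close> (\<open>finite_hilbert_transform_cheb_sin\<close>). For \<open>n = 1\<close> the kernel
  \<open>sqrt (1 - x\<^sup>2) / (x - t)\<close> has an explicit antiderivative, and the remaining cases follow from the
  three-term recurrence shared by \<open>sin (n * \<theta>)\<close> and \<open>cos (n * \<theta>)\<close>. Any two distinct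
  images are at distance at least \<open>2 / 3\<close> in \<open>L\<^sup>1\<close> (\<open>integral_abs_cheb_cos_diff_ge\<close>), so they do not
  lie in a norm compact set.

  The sequence \<open>f\<^sub>n\<close> converges weakly to \<open>0\<close> in \<open>L log L\<close> (\<open>dual_cheb_sin_tendsto_0\<close>). Indeed
  \<open>f\<^sup>* t \<le> B / sqrt t\<close> for a function \<open>f\<close> of \<open>L\<^sup>2\<close> norm at most \<open>B\<close>, and \<open>ln (2 * exp 1 / t) / sqrt t\<close> is
  integrable on \<open>{0<..<2}\<close>, so the \<open>L log L\<close> norm is bounded by a multiple of the \<open>L\<^sup>2\<close> norm. The
  integrals of \<open>f\<^sub>k * f\<^sub>l\<close> with \<open>k \<noteq> l\<close> are nonpositive, hence a sum of \<open>M\<close> of the functions has \<open>L log L\<close>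
  norm at most of order \<open>sqrt M\<close>. A functional whose real part, after multiplication by some constant,
  stayed above \<open>\<delta> > 0\<close> along infinitely many \<open>f\<^sub>n\<close> would be at least of size \<open>M * \<delta>\<close> on such sums.
\<close>

section \<open>Chebyshev functions and their integrals\<close>

text \<open>
  These are \<open>sqrt (1 - x\<^sup>2) * U\<^sub>n\<^sub>-\<^sub>1 x\<close> and \<open>T\<^sub>n x\<close> for the Chebyshev polynomials \<open>U\<close> and \<open>T\<close>, written as
  \<open>sin (n * \<theta>)\<close> and \<open>cos (n * \<theta>)\<close> with \<open>x = cos \<theta>\<close>. Only arguments in \<open>{-1..1}\<close> are meaningful.
\<close>

definition cheb_sin :: "nat \<Rightarrow> real \<Rightarrow> real" where
  "cheb_sin n x = sin (real n * arccos x)"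

definition cheb_cos :: "nat \<Rightarrow> real \<Rightarrow> real" where
  "cheb_cos n x = cos (real n * arccos x)"

lemma continuous_on_cheb_sin [continuous_intros]: "A \<subseteq> {-1..1} \<Longrightarrow> continuous_on A (cheb_sin n)"
  unfolding cheb_sin_def by (rule continuous_on_subset[of "{-1..1}"]) (auto intro!: continuous_intros)

lemma continuous_on_cheb_cos [continuous_intros]: "A \<subseteq> {-1..1} \<Longrightarrow> continuous_on A (cheb_cos n)"
  unfolding cheb_cos_def by (rule continuous_on_subset[of "{-1..1}"]) (auto intro!: continuous_intros)

lemma cheb_sin_0 [simp]: "cheb_sin 0 x = 0"
  by (simp add: cheb_sin_def)

lemma cheb_cos_0 [simp]: "cheb_cos 0 x = 1"
  by (simp add: cheb_cos_def)

lemma abs_cheb_cos_le_1: "\<bar>cheb_cos n x\<bar> \<le> 1"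
  by (simp add: cheb_cos_def)

lemma cheb_sin_1:
  assumes "x \<in> {-1..1}" shows "cheb_sin 1 x = sqrt (1 - x\<^sup>2)"
  using assms by (simp add: cheb_sin_def sin_arccos)

lemma cheb_cos_1:
  assumes "x \<in> {-1..1}" shows "cheb_cos 1 x = x"
  using assms by (simp add: cheb_cos_def)

lemma cheb_sin_recurrence:
  assumes "x \<in> {-1..1}"
  shows "cheb_sin (Suc (Suc n)) x = 2 * x * cheb_sin (Suc n) x - cheb_sin n x"
proof -
  define \<theta> where "\<theta> = arccos x"
  have x: "x = cos \<theta>" using assms by (simp add: \<theta>_def)
  have "sin ((real n+1) * \<theta> + \<theta>) + sin ((real n+1) * \<theta> - \<theta>) = 2 * x * sin ((real n+1) * \<theta>)"
    unfolding x sin_add sin_diff by simp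
  then show ?thesis
    unfolding cheb_sin_def \<theta>_def[symmetric] by (simp add: algebra_simps)
qed

lemma cheb_cos_recurrence:
  assumes "x \<in> {-1..1}"
  shows "cheb_cos (Suc (Suc n)) x = 2 * x * cheb_cos (Suc n) x - cheb_cos n x"
proof -
  define \<theta> where "\<theta> = arccos x"
  have x: "x = cos \<theta>" using assms by (simp add: \<theta>_def)
  have "cos ((real n+1) * \<theta> + \<theta>) + cos ((real n+1) * \<theta> - \<theta>) = 2 * x * cos ((real n+1) * \<theta>)"
    unfolding x cos_add cos_diff by simp
  then show ?thesis
    unfolding cheb_cos_def \<theta>_def[symmetric] by (simp add: algebra_simps)
qed

lemma cheb_sin_mult:
  assumes "m \<le> n"
  shows "cheb_sin n x * cheb_sin m x = (cheb_cos (n - m) x - cheb_cos (n + m) x) / 2"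
  using assms
  by (simp add: cheb_sin_def cheb_cos_def sin_times_sin of_nat_diff left_diff_distrib distrib_right)

lemma cheb_cos_mult:
  assumes "m \<le> n"
  shows "cheb_cos n x * cheb_cos m x = (cheb_cos (n - m) x + cheb_cos (n + m) x) / 2"
  using assms
  by (simp add: cheb_cos_def cos_times_cos of_nat_diff left_diff_distrib distrib_right)

lemma has_real_derivative_comp_arccos:
  assumes "(F has_real_derivative D * sin (arccos x)) (at (arccos x))" "x \<in> {-1<..<1}"
  shows "((\<lambda>x. F (arccos x)) has_real_derivative - D) (at x)"
proof -
  have "sqrt (1 - x\<^sup>2) > 0"
    using assms(2) by (simp add: abs_square_less_1 abs_less_iff)
  moreover have "sin (arccos x) = sqrt (1 - x\<^sup>2)"
    using assms(2) by (simp add: sin_arccos)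
  moreover have "((\<lambda>x. F (arccos x)) has_real_derivative
     (D * sin (arccos x)) * inverse (- sqrt (1 - x\<^sup>2))) (at x)"
    using assms by (intro DERIV_chain2[of F _ arccos] DERIV_arccos) simp_all
  ultimately show ?thesis by (simp add: field_simps)
qed

text \<open>
  The substitution \<open>x = cos \<theta>\<close>, stated for an antiderivative: \<open>F\<close> is differentiable up to the
  endpoints, while \<open>arccos\<close> is only continuous there.
\<close>

lemma has_integral_comp_arccos:
  assumes "\<And>\<theta>. (F has_real_derivative - g \<theta> * sin \<theta>) (at \<theta>)"
  shows "((\<lambda>x. g (arccos x)) has_integral F 0 - F pi) {-1..1}"
proof -
  have "((\<lambda>x. g (arccos x)) has_integral F (arccos 1) - F (arccos (-1))) {-1..1}"
  proof (rule fundamental_theorem_of_calculus_interior)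
    have "continuous_on UNIV F"
      using assms by (meson DERIV_isCont continuous_at_imp_continuous_on)
    then have "continuous_on (arccos ` {-1..1}) F"
      by (rule continuous_on_subset) auto
    then show "continuous_on {-1..1} (\<lambda>x. F (arccos x))"
      by (rule continuous_on_compose2) (auto intro: continuous_on_arccos')
    fix x :: real assume "x \<in> {-1<..<1}"
    from has_real_derivative_comp_arccos[OF assms this]
    show "((\<lambda>x. F (arccos x)) has_vector_derivative g (arccos x)) (at x)"
      by (simp add: has_real_derivative_iff_has_vector_derivative)
  qed simp
  then show ?thesis by simp
qed

text \<open>
  The integral of \<open>cheb_cos n\<close> over \<open>{-1..1}\<close>.
\<close>

definition cheb_mean :: "nat \<Rightarrow> real" where
  "cheb_mean n = (if odd n then 0 else - 2 / ((real n)\<^sup>2 - 1))"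

lemma has_integral_cheb_cos: "(cheb_cos n has_integral cheb_mean n) {-1..1}"
proof (cases "n = 1")
  \<comment> \<open>For \<open>n = 1\<close> the general antiderivative below has denominator \<open>n - 1 = 0\<close>.\<close>
  case True
  have "((\<lambda>x. cos (arccos x)) has_integral (cos 0)\<^sup>2 / 2 - (cos pi)\<^sup>2 / 2) {-1..1}"
    by (rule has_integral_comp_arccos) (auto intro!: derivative_eq_intros)
  then show ?thesis
    using True by (simp add: cheb_cos_def[abs_def] cheb_mean_def)
next
  case False
  define F where "F \<theta> = cos ((real n+1) * \<theta>) / (2 * (real n+1)) - cos ((real n-1) * \<theta>) / (2 * (real n-1))" for \<theta>
  have "real n - 1 \<noteq> 0" using False by simp
  have eq: "(sin ((real n-1) * \<theta>) - sin ((real n+1) * \<theta>)) / 2 = - cos (real n * \<theta>) * sin \<theta>" for \<theta>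
    by (simp add: left_diff_distrib distrib_right sin_add sin_diff)
  have "(F has_real_derivative (sin ((real n-1) * \<theta>) - sin ((real n+1) * \<theta>)) / 2) (at \<theta>)" for \<theta>
    unfolding F_def diff_divide_distrib
    using \<open>real n - 1 \<noteq> 0\<close>
    by (auto intro!: derivative_eq_intros simp: divide_simps) (simp add: algebra_simps)
  then have "(F has_real_derivative - cos (real n * \<theta>) * sin \<theta>) (at \<theta>)" for \<theta>
    by (simp only: eq)
  from has_integral_comp_arccos[OF this]
  have "((\<lambda>x. cos (real n * arccos x)) has_integral F 0 - F pi) {-1..1}" by simp
  moreover have "F 0 - F pi = cheb_mean n"
  proof -
    have 1: "cos ((real n - 1) * pi) = cos ((real n+1) * pi)"
      by (simp add: left_diff_distrib distrib_right cos_diff cos_add)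
    have 2: "cos ((real n+1) * pi) = (if odd n then 1 else -1)"
      using cos_npi[of "n+1"] by (auto simp: minus_one_power_iff add.commute)
    have 3: "(real n)\<^sup>2 - 1 = (real n - 1) * (real n + 1)" by (simp add: power2_eq_square algebra_simps)
    show ?thesis
      unfolding F_def 1 2 cheb_mean_def 3 using \<open>real n - 1 \<noteq> 0\<close>
      by (auto simp: divide_simps) (simp add: algebra_simps)
  qed
  ultimately show ?thesis by (simp add: cheb_cos_def[abs_def])
qed

lemma has_integral_cheb_sin: "(cheb_sin n has_integral (if n = 1 then pi / 2 else 0)) {-1..1}"
proof (cases "n = 1")
  \<comment> \<open>For \<open>n = 1\<close> the general antiderivative below has denominator \<open>n - 1 = 0\<close>.\<close>
  case True
  define F where "F \<theta> = sin (2 * \<theta>) / 4 - \<theta> / 2" for \<theta> :: real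
  have "(F has_real_derivative cos (2 * \<theta>) / 2 - 1 / 2) (at \<theta>)" for \<theta>
    unfolding F_def by (auto intro!: derivative_eq_intros)
  then have "(F has_real_derivative - sin \<theta> * sin \<theta>) (at \<theta>)" for \<theta>
    by (simp add: cos_double_sin power2_eq_square diff_divide_distrib)
  from has_integral_comp_arccos[OF this]
  have "((\<lambda>x. sin (arccos x)) has_integral pi / 2) {-1..1}"
    by (simp add: F_def)
  then show ?thesis
    using True by (simp add: cheb_sin_def[abs_def])
next
  case False
  define F where "F \<theta> = sin ((real n+1) * \<theta>) / (2 * (real n+1)) - sin ((real n-1) * \<theta>) / (2 * (real n-1))" for \<theta>
  have "real n - 1 \<noteq> 0" using False by simp
  have eq: "(cos ((real n+1) * \<theta>) - cos ((real n-1) * \<theta>)) / 2 = - sin (real n * \<theta>) * sin \<theta>" for \<theta>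
    by (simp add: left_diff_distrib distrib_right cos_add cos_diff)
  have "(F has_real_derivative (cos ((real n+1) * \<theta>) - cos ((real n-1) * \<theta>)) / 2) (at \<theta>)" for \<theta>
    unfolding F_def diff_divide_distrib
    using \<open>real n - 1 \<noteq> 0\<close>
    by (auto intro!: derivative_eq_intros simp: divide_simps) (simp add: algebra_simps)
  then have "(F has_real_derivative - sin (real n * \<theta>) * sin \<theta>) (at \<theta>)" for \<theta>
    by (simp only: eq)
  from has_integral_comp_arccos[OF this]
  have "((\<lambda>x. sin (real n * arccos x)) has_integral F 0 - F pi) {-1..1}" by simp
  moreover have "F 0 - F pi = 0"
    unfolding F_def by (simp add: left_diff_distrib distrib_right sin_diff sin_add)
  ultimately show ?thesis using False by (simp add: cheb_sin_def[abs_def])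
qed

lemma cheb_mean_0 [simp]: "cheb_mean 0 = 2"
  by (simp add: cheb_mean_def)

lemma cheb_mean_nonpos: "n \<ge> 1 \<Longrightarrow> cheb_mean n \<le> 0"
  using one_le_power[of "real n" 2] abs_square_less_1[of "real n"] by (auto simp: cheb_mean_def divide_simps)

lemma cheb_mean_even_ge: assumes "n \<ge> 1" shows "cheb_mean (2 * n) \<ge> - 2 / 3"
proof -
  have "(real n)\<^sup>2 \<ge> 1" using assms by simp
  then show ?thesis by (simp add: cheb_mean_def divide_simps power2_eq_square)
qed

lemma cheb_mean_mono:
  assumes "1 \<le> m" "m \<le> n" "even (n - m)"
  shows "cheb_mean m \<le> cheb_mean n"
proof (cases "odd m")
  case True
  then show ?thesis using assms by (simp add: cheb_mean_def)
next
  case False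
  then have "m \<ge> 2" "even n" using assms by (auto elim: evenE)
  then have "(real m)\<^sup>2 \<ge> 2\<^sup>2" "(real n)\<^sup>2 \<ge> (real m)\<^sup>2"
    using assms by (auto intro!: power_mono)
  then show ?thesis
    using False \<open>even n\<close> by (simp add: cheb_mean_def frac_le)
qed

text \<open>
  The functions \<open>cheb_sin n\<close> are not orthogonal for Lebesgue measure, but their inner products have a
  favourable sign. Hence sums of them satisfy the same upper bound as in the orthogonal case.
\<close>

lemma integral_cheb_sin_mult_nonpos:
  assumes "1 \<le> m" "1 \<le> n" "m \<noteq> n"
  shows "integral {-1..1} (\<lambda>x. cheb_sin m x * cheb_sin n x) \<le> 0"
proof -
  have *: "integral {-1..1} (\<lambda>x. cheb_sin n x * cheb_sin m x) \<le> 0" if "1 \<le> m" "m < n" for m n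
  proof -
    have "((\<lambda>x. (cheb_cos (n - m) x - cheb_cos (n + m) x) / 2) has_integral
            (cheb_mean (n - m) - cheb_mean (n + m)) / 2) {-1..1}"
      by (intro has_integral_divide has_integral_diff has_integral_cheb_cos)
    moreover have "cheb_mean (n - m) \<le> cheb_mean (n + m)"
      using that by (intro cheb_mean_mono) auto
    ultimately show ?thesis
      using that by (auto dest!: integral_unique simp: cheb_sin_mult simp del: integral_divide)
  qed
  show ?thesis
    using *[of m n] *[of n m] assms by (cases m n rule: linorder_cases) (auto simp: mult.commute)
qed

lemma integral_cheb_sin_square_le: "integral {-1..1} (\<lambda>x. cheb_sin n x * cheb_sin n x) \<le> 2"
proof -
  have "integral {-1..1} (\<lambda>x. cheb_sin n x * cheb_sin n x) \<le> integral {-1..1} (\<lambda>x::real. 1::real)"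
  proof (rule integral_le)
    show "(\<lambda>x. cheb_sin n x * cheb_sin n x) integrable_on {-1..1}"
      by (intro integrable_continuous_interval continuous_intros) auto
    show "cheb_sin n x * cheb_sin n x \<le> 1" for x
      unfolding cheb_sin_def power2_eq_square[symmetric]
      by (simp add: abs_square_le_1)
  qed auto
  then show ?thesis by simp
qed

lemma integral_sum_cheb_sin_square_le:
  assumes "finite S" "\<And>k. k \<in> S \<Longrightarrow> 1 \<le> k"
  shows "integral {-1..1} (\<lambda>x. (\<Sum>k\<in>S. cheb_sin k x)\<^sup>2) \<le> 2 * card S"
proof -
  have int: "(\<lambda>x. cheb_sin k x * cheb_sin l x) integrable_on {-1..1}" for k l
    by (intro integrable_continuous_interval continuous_intros) auto
  have "integral {-1..1} (\<lambda>x. (\<Sum>k\<in>S. cheb_sin k x)\<^sup>2) =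
        (\<Sum>k\<in>S. \<Sum>l\<in>S. integral {-1..1} (\<lambda>x. cheb_sin k x * cheb_sin l x))"
    using assms(1) int
    by (simp add: power2_eq_square sum_product integral_sum integrable_sum)
  also have "\<dots> \<le> (\<Sum>k\<in>S. \<Sum>l\<in>S. if l = k then 2 else 0)"
    using assms(2)
    by (intro sum_mono) (auto intro: integral_cheb_sin_square_le integral_cheb_sin_mult_nonpos)
  also have "\<dots> = 2 * card S"
    using assms(1) by simp
  finally show ?thesis .
qed

text \<open>
  The values of \<open>cheb_cos\<close> are bounded by \<open>1\<close>, so the difference \<open>d\<close> satisfies \<open>d\<^sup>2 \<le> 2 * \<bar>d\<bar>\<close> and
  a lower bound in \<open>L\<^sup>2\<close> gives one in \<open>L\<^sup>1\<close>.
\<close>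

lemma integral_abs_cheb_cos_diff_ge:
  assumes "1 \<le> m" "1 \<le> n" "m \<noteq> n"
  shows "integral {-1..1} (\<lambda>x. \<bar>cheb_cos m x - cheb_cos n x\<bar>) \<ge> 2 / 3"
proof -
  have *: "integral {-1..1} (\<lambda>x. \<bar>cheb_cos n x - cheb_cos m x\<bar>) \<ge> 2 / 3" if "1 \<le> m" "m < n" for m n
  proof -
    have eq: "(cheb_cos n x - cheb_cos m x)\<^sup>2 = 1 + cheb_cos (2 * n) x / 2 + cheb_cos (2 * m) x / 2
             - cheb_cos (n - m) x - cheb_cos (n + m) x" for x
      using cheb_cos_mult[of m n x] cheb_cos_mult[of n n x] cheb_cos_mult[of m m x] that
      by (simp add: power2_eq_square algebra_simps mult_2 mult_2_right add_divide_distrib)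
    have "((\<lambda>x. (cheb_cos n x - cheb_cos m x)\<^sup>2) has_integral
        (2 + cheb_mean (2 * n) / 2 + cheb_mean (2 * m) / 2
             - cheb_mean (n - m) - cheb_mean (n + m))) {-1..1}"
      unfolding eq
      by (intro has_integral_divide has_integral_diff has_integral_add has_integral_cheb_cos)
         (use has_integral_const_real[of "1::real" "-1" 1] in simp)
    note integral_unique[OF this]
    then have "integral {-1..1} (\<lambda>x. (cheb_cos n x - cheb_cos m x)\<^sup>2) \<ge> 4 / 3"
      using cheb_mean_even_ge[of n] cheb_mean_even_ge[of m] cheb_mean_nonpos[of "n - m"]
        cheb_mean_nonpos[of "n + m"] that by linarith
    moreover have "integral {-1..1} (\<lambda>x. (cheb_cos n x - cheb_cos m x)\<^sup>2)
        \<le> integral {-1..1} (\<lambda>x. 2 * \<bar>cheb_cos n x - cheb_cos m x\<bar>)"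
    proof (rule integral_le)
      fix x
      have "\<bar>cheb_cos n x - cheb_cos m x\<bar> \<le> 2"
        using abs_cheb_cos_le_1[of n x] abs_cheb_cos_le_1[of m x] by linarith
      then show "(cheb_cos n x - cheb_cos m x)\<^sup>2 \<le> 2 * \<bar>cheb_cos n x - cheb_cos m x\<bar>"
        using mult_right_mono[of "\<bar>cheb_cos n x - cheb_cos m x\<bar>" 2 "\<bar>cheb_cos n x - cheb_cos m x\<bar>"]
        by (simp add: power2_eq_square)
    qed (auto intro!: integrable_continuous_interval continuous_intros)
    ultimately show ?thesis by simp
  qed
  show ?thesis
    using *[of m n] *[of n m] assms
    by (cases m n rule: linorder_cases) (auto simp: abs_minus_commute)
qed

section \<open>Classes of measurable functions and the norm of \<open>L\<^sup>1\<close>\<close>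

lemma ae_eq_refl: "f \<in> borel_measurable \<mu> \<Longrightarrow> ae_eq f f"
  by (simp add: ae_eq_def)

lemma abs_L0_cong: "ae_eq f g \<Longrightarrow> abs_L0 f = abs_L0 g"
  by (rule Quotient3_rel_abs[OF Quotient3_L0])

lemma ae_eq_rep_abs_L0: "f \<in> borel_measurable \<mu> \<Longrightarrow> ae_eq (rep_L0 (abs_L0 f)) f"
  by (rule Quotient3_rep_abs[OF Quotient3_L0 ae_eq_refl])

lemma L0_cases:
  obtains f where "f \<in> borel_measurable \<mu>" "x = abs_L0 f"
  by (metis Quotient3_L0 Quotient3_abs_rep Quotient3_rep_reflp ae_eq_def)

lemma enorm_L1_uminus: "enorm_L1 (- f) = enorm_L1 f"
  by transfer simp

lemma enorm_L1_triangle: "enorm_L1 (f + g) \<le> enorm_L1 f + enorm_L1 g"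
proof -
  obtain u where u [measurable]: "u \<in> borel_measurable \<mu>" and f: "f = abs_L0 u" by (rule L0_cases)
  obtain v where v [measurable]: "v \<in> borel_measurable \<mu>" and g: "g = abs_L0 v" by (rule L0_cases)
  have "(\<integral>\<^sup>+x. ennreal (cmod (u x + v x)) \<partial>\<mu>) \<le> (\<integral>\<^sup>+x. ennreal (cmod (u x)) + ennreal (cmod (v x)) \<partial>\<mu>)"
    by (intro nn_integral_mono) (simp flip: ennreal_plus add: norm_triangle_ineq)
  also have "\<dots> = (\<integral>\<^sup>+x. ennreal (cmod (u x)) \<partial>\<mu>) + (\<integral>\<^sup>+x. ennreal (cmod (v x)) \<partial>\<mu>)"
    by (rule nn_integral_add) measurable
  finally show ?thesis
    unfolding f g by (simp add: plus_L0.abs_eq enorm_L1.abs_eq ae_eq_refl)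
qed

lemma enorm_L1_eq_0: "enorm_L1 f = 0 \<longleftrightarrow> f = 0"
proof -
  obtain u where u [measurable]: "u \<in> borel_measurable \<mu>" and f: "f = abs_L0 u" by (rule L0_cases)
  have "enorm_L1 f = 0 \<longleftrightarrow> (AE x in \<mu>. u x = 0)"
    unfolding f by (simp add: enorm_L1.abs_eq ae_eq_refl nn_integral_0_iff_AE)
  also have "\<dots> \<longleftrightarrow> ae_eq u (\<lambda>_. 0)"
    by (simp add: ae_eq_def)
  also have "\<dots> \<longleftrightarrow> f = 0"
    unfolding f zero_L0_def using ae_eq_refl[OF u] ae_eq_refl[of "\<lambda>_. 0"]
    using Quotient3_rel[OF Quotient3_L0, of u "\<lambda>_. 0"] by simp
  finally show ?thesis .
qed

text \<open>
  Needed before anything can be said about \<open>norm_topology L1 norm_L1\<close>, because compactness in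
  \<open>mtopology\<close> is only characterised sequentially once the distance is known to be a metric.
\<close>

lemma Metric_space_L1: "Metric_space L1 (\<lambda>x y. norm_L1 (x - y))"
proof
  show "0 \<le> norm_L1 (x - y)" for x y
    by (simp add: norm_L1_def)
  show "norm_L1 (x - y) = norm_L1 (y - x)" for x y
    using enorm_L1_uminus[of "x - y"] by (simp add: norm_L1_def)
  have fin: "enorm_L1 (x - y) < \<infinity>" if "x \<in> L1" "y \<in> L1" for x y
  proof -
    have "enorm_L1 (x - y) \<le> enorm_L1 x + enorm_L1 y"
      using enorm_L1_triangle[of x "- y"] by (simp add: enorm_L1_uminus)
    also have "\<dots> < \<infinity>" using that by (simp add: L1_def)
    finally show ?thesis .
  qed
  show "norm_L1 (x - y) = 0 \<longleftrightarrow> x = y" if "x \<in> L1" "y \<in> L1" for x y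
    using fin[OF that] by (auto simp: norm_L1_def enn2real_eq_0_iff enorm_L1_eq_0)
  show "norm_L1 (x - z) \<le> norm_L1 (x - y) + norm_L1 (y - z)"
    if "x \<in> L1" "y \<in> L1" "z \<in> L1" for x y z
  proof -
    have "enorm_L1 (x - z) \<le> enorm_L1 (x - y) + enorm_L1 (y - z)"
      using enorm_L1_triangle[of "x - y" "y - z"] by simp
    then have "enn2real (enorm_L1 (x - z)) \<le> enn2real (enorm_L1 (x - y) + enorm_L1 (y - z))"
      using fin that by (intro enn2real_mono) auto
    then show ?thesis
      using fin that by (simp add: norm_L1_def enn2real_plus)
  qed
qed

lemma nn_integral_mu_continuous:
  assumes "continuous_on {-1..1} h" "\<And>x. x \<in> {-1<..<1} \<Longrightarrow> 0 \<le> h x"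
  shows "(\<integral>\<^sup>+x. ennreal (h x) \<partial>\<mu>) = ennreal (integral {-1..1} h)"
proof -
  have "(h has_integral integral {-1..1} h) {-1<..<1}"
    using integrable_continuous_interval[OF assms(1)]
    by (simp add: has_integral_Icc_iff_Ioo[symmetric] has_integral_integral)
  from nn_integral_has_integral_lebesgue[OF assms(2) this]
  show ?thesis
    by (simp add: nn_integral_restrict_space mult.commute ennreal_mult'' ennreal_indicator)
qed

lemma measurable_mu_continuous:
  fixes h :: "real \<Rightarrow> 'a::topological_space"
  assumes "continuous_on {-1<..<1} h"
  shows "h \<in> borel_measurable \<mu>"
proof -
  have "h \<in> borel_measurable (restrict_space borel {-1<..<1})"
    by (rule borel_measurable_continuous_on_restrict[OF assms])
  then show ?thesis
    by (simp cong: measurable_cong_sets add: sets_restrict_space)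
qed

section \<open>Compactness in metric and weak topologies\<close>

lemma (in Metric_space) not_compactin_if_separated:
  fixes f :: "nat \<Rightarrow> 'a"
  assumes "\<And>n. f n \<in> S" "e > 0" "\<And>m n. m \<noteq> n \<Longrightarrow> d (f m) (f n) \<ge> e"
  shows "\<not> compactin mtopology S"
proof
  assume S: "compactin mtopology S"
  then obtain l r where r: "strict_mono r" and "limitin mtopology (f \<circ> r) l sequentially"
    using assms(1) unfolding compactin_sequentially by (metis image_subsetI)
  moreover have "range (f \<circ> r) \<subseteq> M"
    using S assms(1) by (auto simp: compactin_sequentially)
  ultimately have "MCauchy (f \<circ> r)"
    by (intro convergent_imp_MCauchy)
  then obtain N where "\<And>n n'. N \<le> n \<Longrightarrow> N \<le> n' \<Longrightarrow> d (f (r n)) (f (r n')) < e"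
    using \<open>e > 0\<close> unfolding MCauchy_def by (auto simp: o_def) meson
  from this[of N "Suc N"] have "d (f (r N)) (f (r (Suc N))) < e" by simp
  moreover have "r N \<noteq> r (Suc N)"
    using r by (simp add: strict_mono_eq)
  ultimately show False
    using assms(3) by (meson not_le)
qed

text \<open>
  Every point of \<open>V\<close> lies in a generating set, namely the preimage of \<open>UNIV\<close> under the zero
  functional.
\<close>

lemma topspace_weak_topology: "topspace (weak_topology sc V N) = V"
proof -
  have "(\<lambda>_. 0) \<in> continuous_dual sc V N"
    by (auto simp: continuous_dual_def intro: exI[of _ 0])
  then show ?thesis
    unfolding weak_topology_def by (auto simp: topology_generated_by_topspace intro!: exI[of _ UNIV])
qed

lemma limitin_topology_generated_by:
  assumes "l \<in> \<Union>\<S>" "\<And>U. U \<in> \<S> \<Longrightarrow> l \<in> U \<Longrightarrow> eventually (\<lambda>n. x n \<in> U) F"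
  shows "limitin (topology_generated_by \<S>) x l F"
proof -
  have "eventually (\<lambda>n. x n \<in> U) F" if "generate_topology_on \<S> U" "l \<in> U" for U
    using that
  proof induction
    case (Int a b)
    then show ?case by (auto intro: eventually_conj elim: eventually_mono)
  next
    case (UN K)
    then obtain k where "k \<in> K" "l \<in> k" by blast
    with UN.IH[of k] show ?case by (auto elim: eventually_mono)
  qed (use assms in auto)
  then show ?thesis
    using assms(1) by (auto simp: limitin_def openin_topology_generated_by_iff)
qed

lemma limitin_weak_topology:
  assumes "l \<in> V" "\<And>n. x n \<in> V"
    and "\<And>\<phi>. \<phi> \<in> continuous_dual sc V N \<Longrightarrow> ((\<lambda>n. \<phi> (x n)) \<longlongrightarrow> \<phi> l) F"
  shows "limitin (weak_topology sc V N) x l F"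
  unfolding weak_topology_def
proof (rule limitin_topology_generated_by)
  show "l \<in> \<Union> {{x \<in> V. \<phi> x \<in> U} |\<phi> U. \<phi> \<in> continuous_dual sc V N \<and> open U}"
    using topspace_weak_topology[of sc V N] assms(1)
    unfolding weak_topology_def by simp
next
  fix W assume "W \<in> {{x \<in> V. \<phi> x \<in> U} |\<phi> U. \<phi> \<in> continuous_dual sc V N \<and> open U}" "l \<in> W"
  then show "eventually (\<lambda>n. x n \<in> W) F"
    using assms(2) topological_tendstoD[OF assms(3)] by auto
qed

lemma compactin_weak_topology_sequence:
  assumes "limitin (weak_topology sc V N) x l sequentially" "\<And>n. x n \<in> V"
  shows "compactin (weak_topology sc V N) (insert l (range x))"
  using assms by (intro compactin_sequence_with_limit) (auto simp: topspace_weak_topology)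

section \<open>Principal values of the Chebyshev functions\<close>

text \<open>
  The truncated principal value integral of \<open>cheb_sin n\<close>, without the factor \<open>1 / pi\<close>, as a
  Henstock-Kurzweil integral. It is meaningful when \<open>0 < \<epsilon>\<close> and \<open>{t - \<epsilon>..t + \<epsilon>} \<subseteq> {-1<..<1}\<close>.
\<close>

definition truncated_cheb_integral :: "nat \<Rightarrow> real \<Rightarrow> real \<Rightarrow> real" where
  "truncated_cheb_integral n \<epsilon> t =
     integral {-1..t - \<epsilon>} (\<lambda>x. cheb_sin n x / (x - t)) +
     integral {t + \<epsilon>..1} (\<lambda>x. cheb_sin n x / (x - t))"

lemma tendsto_at_right_0_shift:
  fixes h :: "real \<Rightarrow> real"
  assumes "isCont h t"
  shows "((\<lambda>\<epsilon>. h (t - \<epsilon>)) \<longlongrightarrow> h t) (at_right 0)" "((\<lambda>\<epsilon>. h (t + \<epsilon>)) \<longlongrightarrow> h t) (at_right 0)"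
  by (rule isCont_tendsto_compose[OF assms] tendsto_eq_intros refl | simp)+

lemma eventually_at_right_0_interval:
  fixes t :: real
  assumes "t \<in> {-1<..<1}"
  shows "eventually (\<lambda>\<epsilon>. 0 < \<epsilon> \<and> -1 < t - \<epsilon> \<and> t + \<epsilon> < 1) (at_right 0)"
  unfolding eventually_at_right_field
  using assms by (intro exI[of _ "min (1 + t) (1 - t)"]) auto

lemma tendsto_integral_outside:
  fixes h :: "real \<Rightarrow> real"
  assumes h: "continuous_on {-1..1} h" and t: "t \<in> {-1<..<1}"
  shows "((\<lambda>\<epsilon>. integral {-1..t - \<epsilon>} h + integral {t + \<epsilon>..1} h) \<longlongrightarrow> integral {-1..1} h) (at_right 0)"
proof -
  define H where "H x = integral {-1..x} h" for x
  have int: "h integrable_on {-1..1}"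
    by (rule integrable_continuous_interval[OF h])
  have "isCont H t"
    using indefinite_integral_continuous_1[OF int] t
    unfolding H_def[symmetric] by (intro continuous_on_interior[where S = "{-1..1}"]) auto
  then have "((\<lambda>\<epsilon>. H (t - \<epsilon>) + (H 1 - H (t + \<epsilon>))) \<longlongrightarrow> H t + (H 1 - H t)) (at_right 0)"
    by (intro tendsto_intros tendsto_at_right_0_shift)
  moreover have "eventually (\<lambda>\<epsilon>. integral {-1..t - \<epsilon>} h + integral {t + \<epsilon>..1} h = H (t - \<epsilon>) + (H 1 - H (t + \<epsilon>))) (at_right 0)"
    using eventually_at_right_0_interval[OF t]
  proof eventually_elim
    case (elim \<epsilon>)
    then have "H (t + \<epsilon>) + integral {t + \<epsilon>..1} h = H 1"
      unfolding H_def using t int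
      by (intro Henstock_Kurzweil_Integration.integral_combine) auto
    then show ?case by (simp add: H_def)
  qed
  ultimately show ?thesis
    by (simp add: H_def[of 1] tendsto_cong)
qed

text \<open>
  The recurrence \<open>cheb_sin_recurrence\<close> carries over after writing \<open>2 * x\<close> as
  \<open>2 * (x - t) + 2 * t\<close>; the first summand cancels the kernel.
\<close>

lemma truncated_cheb_integral_recurrence:
  assumes t: "t \<in> {-1<..<1}" and e: "0 < \<epsilon>" "-1 < t - \<epsilon>" "t + \<epsilon> < 1"
  shows "truncated_cheb_integral (Suc (Suc n)) \<epsilon> t =
     2 * (integral {-1..t - \<epsilon>} (cheb_sin (Suc n)) + integral {t + \<epsilon>..1} (cheb_sin (Suc n)))
     + 2 * t * truncated_cheb_integral (Suc n) \<epsilon> t - truncated_cheb_integral n \<epsilon> t"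
proof -
  have *: "integral {a..b} (\<lambda>x. cheb_sin (Suc (Suc n)) x / (x - t)) =
      2 * integral {a..b} (cheb_sin (Suc n)) + 2 * t * integral {a..b} (\<lambda>x. cheb_sin (Suc n) x / (x - t))
      - integral {a..b} (\<lambda>x. cheb_sin n x / (x - t))"
    if ab: "{a..b} \<subseteq> {-1..1} - {t}" for a b
  proof -
    have i: "(\<lambda>x. cheb_sin k x / (x - t)) integrable_on {a..b}" "cheb_sin k integrable_on {a..b}" for k
      using ab by (auto intro!: integrable_continuous_interval continuous_intros)
    have "integral {a..b} (\<lambda>x. cheb_sin (Suc (Suc n)) x / (x - t)) =
       integral {a..b} (\<lambda>x. 2 * cheb_sin (Suc n) x + (2 * t) * (cheb_sin (Suc n) x / (x - t)) - cheb_sin n x / (x - t))"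
    proof (rule integral_cong)
      fix x assume x: "x \<in> {a..b}"
      with ab have "x \<in> {-1..1}" "x - t \<noteq> 0" by auto
      moreover have "2 * x * p - q = 2 * p * (x - t) + (2 * t) * p - q" for p q :: real
        by (simp add: algebra_simps)
      ultimately show "cheb_sin (Suc (Suc n)) x / (x - t) =
         2 * cheb_sin (Suc n) x + (2 * t) * (cheb_sin (Suc n) x / (x - t)) - cheb_sin n x / (x - t)"
        by (simp add: cheb_sin_recurrence add_divide_distrib diff_divide_distrib)
    qed
    also have "\<dots> = 2 * integral {a..b} (cheb_sin (Suc n)) + 2 * t * integral {a..b} (\<lambda>x. cheb_sin (Suc n) x / (x - t))
      - integral {a..b} (\<lambda>x. cheb_sin n x / (x - t))"
      by (intro integral_unique has_integral_diff has_integral_add has_integral_mult_right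
          integrable_integral i)
    finally show ?thesis .
  qed
  have "{-1..t - \<epsilon>} \<subseteq> {-1..1} - {t}" "{t + \<epsilon>..1} \<subseteq> {-1..1} - {t}"
    using t e by auto
  from *[OF this(1)] *[OF this(2)] show ?thesis
    unfolding truncated_cheb_integral_def by (simp add: algebra_simps)
qed

text \<open>
  For the semicircle function \<open>cheb_sin 1 x = sqrt (1 - x\<^sup>2)\<close> the kernel has an elementary
  antiderivative, continuous on \<open>{-1..1} - {t}\<close>. Its only singular part at \<open>t\<close> is the even function
  \<open>ln ((x - t)\<^sup>2)\<close> of \<open>x - t\<close>, which cancels in the symmetric truncation.
\<close>

lemma has_integral_semicircle_kernel:
  fixes t :: real
  assumes t: "t \<in> {-1<..<1}" and "a \<le> b" and ab: "{a..b} \<subseteq> {-1..1} - {t}"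
  defines "r \<equiv> sqrt (1 - t\<^sup>2)"
  defines "G \<equiv> \<lambda>x. r * (ln ((x - t)\<^sup>2) / 2 - ln (1 - t * x + r * sqrt (1 - x\<^sup>2)))
                  + (sqrt (1 - x\<^sup>2) - t * arcsin x)"
  shows "((\<lambda>x. cheb_sin 1 x / (x - t)) has_integral G b - G a) {a..b}"
proof (rule fundamental_theorem_of_calculus_interior)
  have t2: "t\<^sup>2 < 1" using t by (simp add: abs_square_less_1 abs_less_iff)
  then have r: "r > 0" "r\<^sup>2 = 1 - t\<^sup>2" by (auto simp: r_def)
  have D: "1 - t * x + r * sqrt (1 - x\<^sup>2) > 0" if "x \<in> {-1..1}" for x
  proof -
    have "\<bar>t * x\<bar> \<le> \<bar>t\<bar> * 1" unfolding abs_mult using that by (intro mult_left_mono) auto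
    then have "t * x < 1" using t by auto
    moreover have "sqrt (1 - x\<^sup>2) \<ge> 0" using that by (simp add: abs_square_le_1 abs_le_iff)
    ultimately show ?thesis using r by (simp add: add_pos_nonneg)
  qed
  show "continuous_on {a..b} G"
    unfolding G_def using ab D by (intro continuous_intros) force+
  fix x assume x: "x \<in> {a<..<b}"
  have "x \<in> {a..b}" "a \<in> {a..b}" "b \<in> {a..b}" using x by auto
  then have "x \<in> {-1..1} - {t}" "a \<in> {-1..1} - {t}" "b \<in> {-1..1} - {t}" using ab by blast+
  with x have x1: "x \<in> {-1<..<1}" and xt: "x - t \<noteq> 0" by auto
  define s where "s = sqrt (1 - x\<^sup>2)"
  have x2: "x\<^sup>2 < 1" using x1 by (simp add: abs_square_less_1 abs_less_iff)
  then have s: "s > 0" "s\<^sup>2 = 1 - x\<^sup>2" by (auto simp: s_def)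
  define d where "d = 1 - t * x + r * s"
  have d: "d > 0" using D[of x] x1 by (simp add: d_def s_def)
  have "(G has_real_derivative
      r * (1 / (x - t) - (- t - r * x / s) / d) + (- x / s - t * (1 / s))) (at x)"
  proof -
    have 1: "((\<lambda>x. sqrt (1 - x\<^sup>2)) has_real_derivative - x / s) (at x)"
      using x2 by (auto intro!: derivative_eq_intros simp: s_def field_simps)
    have 2: "((\<lambda>x. ln (1 - t * x + r * sqrt (1 - x\<^sup>2))) has_real_derivative (- t - r * x / s) / d) (at x)"
    proof -
      have "((\<lambda>x. 1 - t * x + r * sqrt (1 - x\<^sup>2)) has_real_derivative - t - r * x / s) (at x)"
        by (rule 1 derivative_eq_intros refl | simp)+
      from DERIV_chain2[OF DERIV_ln_divide this] d show ?thesis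
        by (simp add: d_def s_def)
    qed
    have 3: "((\<lambda>x. ln ((x - t)\<^sup>2) / 2) has_real_derivative 1 / (x - t)) (at x)"
    proof -
      have "((\<lambda>x. (x - t)\<^sup>2) has_real_derivative 2 * (x - t)) (at x)"
        by (auto intro!: derivative_eq_intros)
      from DERIV_cdivide[OF DERIV_chain2[OF DERIV_ln_divide this], of 2] xt
      have "((\<lambda>x. ln ((x - t)\<^sup>2) / 2) has_real_derivative 1 / (x - t)\<^sup>2 * (2 * (x - t)) / 2) (at x)"
        by simp
      also have "1 / (x - t)\<^sup>2 * (2 * (x - t)) / 2 = 1 / (x - t)"
      proof -
        have "1 / y\<^sup>2 * (2 * y) / 2 = 1 / y" if "y \<noteq> 0" for y :: real
          using that by (simp add: power2_eq_square)
        then show ?thesis using xt .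
      qed
      finally show ?thesis .
    qed
    have 4: "(arcsin has_real_derivative 1 / s) (at x)"
      using DERIV_arcsin[of x] x1 by (simp add: s_def inverse_eq_divide)
    show ?thesis
      unfolding G_def by (intro DERIV_add DERIV_diff DERIV_cmult 1 2 3 4)
  qed
  also have "1 / (x - t) - (- t - r * x / s) / d = r / (s * (x - t))"
  proof -
    have "s * d + (t * s + r * x) * (x - t) = s * (1 - t\<^sup>2) + r * (s\<^sup>2 + x\<^sup>2) - r * x * t"
      by (simp add: d_def algebra_simps power2_eq_square)
    also have "\<dots> = s * r\<^sup>2 + r - r * x * t"
      using s r by simp
    also have "\<dots> = r * d"
      by (simp add: d_def algebra_simps power2_eq_square)
    finally have eq: "s * d + (t * s + r * x) * (x - t) = r * d" .
    have "d - (- t - r * x / s) * (x - t) = (s * d + (t * s + r * x) * (x - t)) / s"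
      using s(1) by (simp add: add_divide_distrib left_diff_distrib distrib_right)
    then have "1 * d - (- t - r * x / s) * (x - t) = r / s * d"
      by (simp add: eq)
    then have "1 / (x - t) - (- t - r * x / s) / d = (r / s * d) / ((x - t) * d)"
      using diff_frac_eq[of "x - t" d 1 "- t - r * x / s"] xt d by (simp only:) simp
    also have "\<dots> = r / (s * (x - t))"
      using d by simp
    finally show ?thesis .
  qed
  also have "r * (r / (s * (x - t))) + (- x / s - t * (1 / s)) = (r\<^sup>2 - (x + t) * (x - t)) / (s * (x - t))"
    by (simp only: diff_divide_distrib power2_eq_square mult_divide_mult_cancel_right[OF xt]) (simp add: add_divide_distrib)
  also have "r\<^sup>2 - (x + t) * (x - t) = s * s"
    using s(2) r(2) by (simp add: power2_eq_square algebra_simps)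
  also have "s * s / (s * (x - t)) = s / (x - t)"
    using s by simp
  finally show "(G has_vector_derivative cheb_sin 1 x / (x - t)) (at x)"
    using x1 cheb_sin_1[of x] by (simp add: s_def has_real_derivative_iff_has_vector_derivative)
qed (use assms in auto)

lemma tendsto_truncated_cheb_integral_1:
  assumes t: "t \<in> {-1<..<1}"
  shows "((\<lambda>\<epsilon>. truncated_cheb_integral 1 \<epsilon> t) \<longlongrightarrow> - pi * t) (at_right 0)"
proof -
  define r where "r = sqrt (1 - t\<^sup>2)"
  \<comment> \<open>\<open>h\<close> is the part of the antiderivative \<open>G\<close> that is continuous at \<open>t\<close>.\<close>
  define h where "h x = sqrt (1 - x\<^sup>2) - t * arcsin x - r * ln (1 - t * x + r * sqrt (1 - x\<^sup>2))" for x
  define G where "G x = r * (ln ((x - t)\<^sup>2) / 2 - ln (1 - t * x + r * sqrt (1 - x\<^sup>2)))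
                  + (sqrt (1 - x\<^sup>2) - t * arcsin x)" for x
  have t2: "t\<^sup>2 < 1" using t by (simp add: abs_square_less_1 abs_less_iff)
  have "1 - t * t + r * sqrt (1 - t\<^sup>2) > 0"
    using t2 by (simp add: r_def power2_eq_square)
  then have "isCont h t"
    unfolding h_def using t by (intro continuous_intros isCont_arcsin) auto
  then have "((\<lambda>\<epsilon>. h (t - \<epsilon>) - h (t + \<epsilon>) + (G 1 - G (-1))) \<longlongrightarrow> h t - h t + (G 1 - G (-1))) (at_right 0)"
    by (intro tendsto_intros tendsto_at_right_0_shift)
  moreover have "G 1 - G (-1) = - pi * t"
  proof -
    have "(-1 - t)\<^sup>2 = (1 + t)\<^sup>2" by (simp add: power2_eq_square algebra_simps)
    then show ?thesis using t by (simp add: G_def ln_realpow)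
  qed
  moreover have "eventually (\<lambda>\<epsilon>. truncated_cheb_integral 1 \<epsilon> t = h (t - \<epsilon>) - h (t + \<epsilon>) + (G 1 - G (-1))) (at_right 0)"
    using eventually_at_right_0_interval[OF t]
  proof eventually_elim
    case (elim \<epsilon>)
    have "((\<lambda>x. cheb_sin 1 x / (x - t)) has_integral G (t - \<epsilon>) - G (-1)) {-1..t - \<epsilon>}"
      unfolding G_def r_def using elim t by (intro has_integral_semicircle_kernel) auto
    moreover have "((\<lambda>x. cheb_sin 1 x / (x - t)) has_integral G 1 - G (t + \<epsilon>)) {t + \<epsilon>..1}"
      unfolding G_def r_def using elim t by (intro has_integral_semicircle_kernel) auto
    ultimately have "truncated_cheb_integral 1 \<epsilon> t = G (t - \<epsilon>) - G (-1) + (G 1 - G (t + \<epsilon>))"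
      unfolding truncated_cheb_integral_def by (simp add: integral_unique)
    also have "G (t - \<epsilon>) - G (t + \<epsilon>) = h (t - \<epsilon>) - h (t + \<epsilon>)"
      by (simp add: G_def h_def algebra_simps)
    then have "G (t - \<epsilon>) - G (-1) + (G 1 - G (t + \<epsilon>)) = h (t - \<epsilon>) - h (t + \<epsilon>) + (G 1 - G (-1))"
      by linarith
    finally show ?case .
  qed
  ultimately show ?thesis
    by (simp add: tendsto_cong)
qed

text \<open>
  Both \<open>cheb_sin\<close> and \<open>cheb_cos\<close> satisfy the Chebyshev recurrence, and the additional term
  \<open>2 * integral {-1..1} (cheb_sin (Suc n))\<close> is nonzero only for \<open>Suc n = 1\<close>. There it accounts for
  the different values at index \<open>0\<close>: the principal value of \<open>cheb_sin 0 = 0\<close> is \<open>0\<close>, whereas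
  \<open>cheb_cos 0 = 1\<close>. The identity therefore starts at index \<open>1\<close>.
\<close>

lemma tendsto_truncated_cheb_integral:
  assumes t: "t \<in> {-1<..<1}"
  shows "((\<lambda>\<epsilon>. truncated_cheb_integral (Suc n) \<epsilon> t) \<longlongrightarrow> - pi * cheb_cos (Suc n) t) (at_right 0)"
proof -
  have step: "((\<lambda>\<epsilon>. truncated_cheb_integral (Suc (Suc n)) \<epsilon> t) \<longlongrightarrow>
        2 * (if Suc n = 1 then pi / 2 else 0) + 2 * t * A - B) (at_right 0)"
    if "((\<lambda>\<epsilon>. truncated_cheb_integral (Suc n) \<epsilon> t) \<longlongrightarrow> A) (at_right 0)"
       "((\<lambda>\<epsilon>. truncated_cheb_integral n \<epsilon> t) \<longlongrightarrow> B) (at_right 0)" for n A B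
  proof (rule Lim_transform_eventually)
    show "((\<lambda>\<epsilon>. 2 * (integral {-1..t - \<epsilon>} (cheb_sin (Suc n)) + integral {t + \<epsilon>..1} (cheb_sin (Suc n)))
        + 2 * t * truncated_cheb_integral (Suc n) \<epsilon> t - truncated_cheb_integral n \<epsilon> t) \<longlongrightarrow>
        2 * (if Suc n = 1 then pi / 2 else 0) + 2 * t * A - B) (at_right 0)"
      unfolding integral_unique[OF has_integral_cheb_sin, symmetric]
      by (intro tendsto_intros tendsto_integral_outside that t continuous_intros) simp
    show "eventually (\<lambda>\<epsilon>. 2 * (integral {-1..t - \<epsilon>} (cheb_sin (Suc n)) + integral {t + \<epsilon>..1} (cheb_sin (Suc n)))
        + 2 * t * truncated_cheb_integral (Suc n) \<epsilon> t - truncated_cheb_integral n \<epsilon> t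
        = truncated_cheb_integral (Suc (Suc n)) \<epsilon> t) (at_right 0)"
      using eventually_at_right_0_interval[OF t]
      by eventually_elim (use t in \<open>simp add: truncated_cheb_integral_recurrence\<close>)
  qed
  have cheb_1: "cheb_cos (Suc 0) t = t"
    using cheb_cos_1[of t] t by simp
  show ?thesis
  proof (induction n rule: induct_nat_012)
    case 0
    show ?case using tendsto_truncated_cheb_integral_1[OF t] cheb_1 by simp
  next
    case 1
    have "((\<lambda>\<epsilon>. truncated_cheb_integral 0 \<epsilon> t) \<longlongrightarrow> 0) (at_right 0)"
      by (simp add: truncated_cheb_integral_def)
    from step[OF _ this] tendsto_truncated_cheb_integral_1[OF t]
    have "((\<lambda>\<epsilon>. truncated_cheb_integral (Suc (Suc 0)) \<epsilon> t) \<longlongrightarrow> pi + 2 * t * (- pi * t)) (at_right 0)"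
      by fastforce
    then show ?case
      using cheb_cos_recurrence[of t 0] t by (simp add: cheb_1 right_diff_distrib mult_ac)
  next
    case (ge2 n)
    from step[OF ge2(2,1)]
    show ?case
      using cheb_cos_recurrence[of t "Suc n"] t by (simp add: right_diff_distrib mult_ac)
  qed
qed

lemma set_integral_kernel_eq:
  assumes u: "ae_eq u (\<lambda>x. complex_of_real (cheb_sin n x))" and ab: "{a..b} \<subseteq> {-1..1} - {t}"
  shows "(LBINT x:{a<..<b}. u x / complex_of_real (x - t)) =
         complex_of_real (integral {a..b} (\<lambda>x. cheb_sin n x / (x - t)))"
proof -
  have sub: "{a<..<b} \<subseteq> {-1<..<1::real}"
  proof
    fix x assume x: "x \<in> {a<..<b}"
    then have "a \<in> {a..b}" "b \<in> {a..b}" by auto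
    with ab have "a \<in> {-1..1}" "b \<in> {-1..1}" by blast+
    with x show "x \<in> {-1<..<1}" by auto
  qed
  \<comment> \<open>\<open>v\<close> is unconstrained outside \<open>{-1<..<1}\<close>; it is cut off there before measurability is used.\<close>
  have meas: "(\<lambda>x. indicator {a<..<b} x *\<^sub>R (v x / complex_of_real (x - t))) \<in> borel_measurable lborel"
    if "v \<in> borel_measurable \<mu>" for v
  proof -
    have [measurable]: "(\<lambda>x. indicator {-1<..<1} x *\<^sub>R v x) \<in> borel_measurable lborel"
      using that by (subst (asm) borel_measurable_restrict_space_iff) auto
    have "(\<lambda>x. indicator {a<..<b} x *\<^sub>R ((indicator {-1<..<1} x *\<^sub>R v x) / complex_of_real (x - t))) \<in> borel_measurable lborel"
      by measurable
    also have "(\<lambda>x. indicator {a<..<b} x *\<^sub>R ((indicator {-1<..<1} x *\<^sub>R v x) / complex_of_real (x - t)))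
        = (\<lambda>x. indicator {a<..<b} x *\<^sub>R (v x / complex_of_real (x - t)))"
      using sub by (auto simp: fun_eq_iff indicator_def)
    finally show ?thesis .
  qed
  have "(LBINT x:{a<..<b}. u x / complex_of_real (x - t)) =
        (LBINT x:{a<..<b}. complex_of_real (cheb_sin n x) / complex_of_real (x - t))"
    unfolding set_lebesgue_integral_def
  proof (rule integral_cong_AE)
    have "AE x in lborel. x \<in> {-1<..<1} \<longrightarrow> u x = complex_of_real (cheb_sin n x)"
      using u by (simp add: ae_eq_def AE_restrict_space_iff)
    then show "AE x in lborel. indicator {a<..<b} x *\<^sub>R (u x / complex_of_real (x - t)) =
       indicator {a<..<b} x *\<^sub>R (complex_of_real (cheb_sin n x) / complex_of_real (x - t))"
      by eventually_elim (use sub in \<open>auto simp: indicator_def\<close>)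
  qed (rule meas, use u in \<open>simp add: ae_eq_def\<close>)+
  also have "\<dots> = (LBINT x:{a<..<b}. complex_of_real (cheb_sin n x / (x - t)))"
    by simp
  also have "\<dots> = complex_of_real (LBINT x:{a<..<b}. cheb_sin n x / (x - t))"
    by (rule set_integral_complex_of_real)
  also have "(LBINT x:{a<..<b}. cheb_sin n x / (x - t)) = integral {a<..<b} (\<lambda>x. cheb_sin n x / (x - t))"
  proof -
    have "continuous_on {a..b} (\<lambda>x. cheb_sin n x / (x - t))"
      using ab by (intro continuous_intros) auto
    then have "set_integrable lborel {a..b} (\<lambda>x. cheb_sin n x / (x - t))"
      by (rule borel_integrable_atLeastAtMost')
    then have "set_integrable lborel {a<..<b} (\<lambda>x. cheb_sin n x / (x - t))"
      by (rule set_integrable_subset) auto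
    then show ?thesis by (rule set_borel_integral_eq_integral(2))
  qed
  also have "\<dots> = integral {a..b} (\<lambda>x. cheb_sin n x / (x - t))"
    by (simp add: integral_open_interval_real)
  finally show ?thesis .
qed

lemma tendsto_truncated_hilbert_cheb_sin:
  assumes u: "ae_eq u (\<lambda>x. complex_of_real (cheb_sin (Suc n) x))" and t: "t \<in> {-1<..<1}"
  shows "((\<lambda>\<epsilon>. truncated_hilbert u \<epsilon> t) \<longlongrightarrow> complex_of_real (- cheb_cos (Suc n) t)) (at_right 0)"
proof (rule Lim_transform_eventually)
  have "((\<lambda>\<epsilon>. complex_of_real (truncated_cheb_integral (Suc n) \<epsilon> t / pi)) \<longlongrightarrow>
         complex_of_real (- pi * cheb_cos (Suc n) t / pi)) (at_right 0)"
    by (intro tendsto_intros tendsto_truncated_cheb_integral t) simp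
  then show "((\<lambda>\<epsilon>. complex_of_real (truncated_cheb_integral (Suc n) \<epsilon> t / pi)) \<longlongrightarrow>
         complex_of_real (- cheb_cos (Suc n) t)) (at_right 0)" by simp
  show "eventually (\<lambda>\<epsilon>. complex_of_real (truncated_cheb_integral (Suc n) \<epsilon> t / pi) = truncated_hilbert u \<epsilon> t) (at_right 0)"
    using eventually_at_right_0_interval[OF t]
  proof eventually_elim
    case (elim \<epsilon>)
    have "{-1..t - \<epsilon>} \<subseteq> {-1..1} - {t}" "{t + \<epsilon>..1} \<subseteq> {-1..1} - {t}"
      using t elim by auto
    from set_integral_kernel_eq[OF u this(1)] set_integral_kernel_eq[OF u this(2)]
    show ?case
      by (simp add: truncated_hilbert_def truncated_cheb_integral_def)
  qed
qed

section \<open>The transform of the Chebyshev functions\<close>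

text \<open>
  The class in \<open>L0\<close> of a real function. It is used only for functions continuous on \<open>{-1<..<1}\<close>, for
  which the representative is measurable.
\<close>

definition fun_L0 :: "(real \<Rightarrow> real) \<Rightarrow> L0" where
  "fun_L0 u = abs_L0 (\<lambda>x. complex_of_real (u x))"

lemma ae_eq_of_real_refl:
  "continuous_on {-1<..<1} u \<Longrightarrow> ae_eq (\<lambda>x. complex_of_real (u x)) (\<lambda>x. complex_of_real (u x))"
  by (intro ae_eq_refl measurable_mu_continuous continuous_intros)

lemma fun_L0_diff:
  assumes "continuous_on {-1<..<1} u" "continuous_on {-1<..<1} v"
  shows "fun_L0 u - fun_L0 v = fun_L0 (\<lambda>x. u x - v x)"
  using assms by (simp add: fun_L0_def minus_L0.abs_eq ae_eq_of_real_refl)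

lemma fun_L0_sum:
  assumes "finite S" "\<And>k. k \<in> S \<Longrightarrow> continuous_on {-1<..<1} (u k)"
  shows "(\<Sum>k\<in>S. fun_L0 (u k)) = fun_L0 (\<lambda>x. \<Sum>k\<in>S. u k x)"
  using assms
proof (induction rule: finite_induct)
  case empty
  then show ?case by (simp add: fun_L0_def zero_L0_def)
next
  case (insert k S)
  have "continuous_on {-1<..<1} (\<lambda>x. \<Sum>k\<in>S. u k x)"
    using insert by (intro continuous_on_sum) auto
  then show ?case
    using insert by (simp add: fun_L0_def plus_L0.abs_eq ae_eq_of_real_refl flip: of_real_sum)
qed

lemma enorm_L1_fun_L0:
  assumes "continuous_on {-1..1} u"
  shows "enorm_L1 (fun_L0 u) = ennreal (integral {-1..1} (\<lambda>x. \<bar>u x\<bar>))"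
proof -
  have "continuous_on {-1<..<1} u" by (rule continuous_on_subset[OF assms]) auto
  then have "enorm_L1 (fun_L0 u) = (\<integral>\<^sup>+x. ennreal \<bar>u x\<bar> \<partial>\<mu>)"
    by (simp add: fun_L0_def enorm_L1.abs_eq ae_eq_of_real_refl)
  also have "\<dots> = ennreal (integral {-1..1} (\<lambda>x. \<bar>u x\<bar>))"
    by (intro nn_integral_mu_continuous continuous_intros assms) auto
  finally show ?thesis .
qed

lemma norm_L1_fun_L0:
  assumes "continuous_on {-1..1} u"
  shows "norm_L1 (fun_L0 u) = integral {-1..1} (\<lambda>x. \<bar>u x\<bar>)"
  using assms by (simp add: norm_L1_def enorm_L1_fun_L0 integral_nonneg integrable_continuous_interval continuous_intros)

lemma finite_hilbert_transform_cheb_sin: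
  "finite_hilbert_transform (fun_L0 (cheb_sin (Suc n))) = fun_L0 (\<lambda>t. - cheb_cos (Suc n) t)"
proof -
  define u where "u = rep_L0 (fun_L0 (cheb_sin (Suc n)))"
  have "continuous_on {-1<..<1} (cheb_sin (Suc n))" by (intro continuous_intros) auto
  then have u: "ae_eq u (\<lambda>x. complex_of_real (cheb_sin (Suc n) x))"
    unfolding u_def fun_L0_def by (intro ae_eq_rep_abs_L0 measurable_mu_continuous continuous_on_of_real)
  have lim: "Lim (at_right 0) (\<lambda>\<epsilon>. truncated_hilbert u \<epsilon> t) = complex_of_real (- cheb_cos (Suc n) t)"
    if "t \<in> {-1<..<1}" for t
    by (rule tendsto_Lim[OF _ tendsto_truncated_hilbert_cheb_sin[OF u that]]) simp
  have meas: "(\<lambda>t. complex_of_real (- cheb_cos (Suc n) t)) \<in> borel_measurable \<mu>"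
    by (intro measurable_mu_continuous continuous_intros) auto
  have "ae_eq (\<lambda>t. Lim (at_right 0) (\<lambda>\<epsilon>. truncated_hilbert u \<epsilon> t)) (\<lambda>t. complex_of_real (- cheb_cos (Suc n) t))"
    unfolding ae_eq_def
  proof (intro conjI meas)
    show "(\<lambda>t. Lim (at_right 0) (\<lambda>\<epsilon>. truncated_hilbert u \<epsilon> t)) \<in> borel_measurable \<mu>"
      by (rule measurable_cong[THEN iffD2, OF _ meas]) (simp add: lim space_restrict_space)
    show "AE t in \<mu>. Lim (at_right 0) (\<lambda>\<epsilon>. truncated_hilbert u \<epsilon> t) = complex_of_real (- cheb_cos (Suc n) t)"
      by (rule AE_I2) (simp add: lim space_restrict_space)
  qed
  then show ?thesis
    unfolding finite_hilbert_transform_def u_def fun_L0_def by (rule abs_L0_cong)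
qed

section \<open>An embedding into \<open>L log L\<close>\<close>

text \<open>
  The weight in the norm of \<open>LlogL\<close> satisfies
  \<open>ln (2 * exp 1 / t) \<le> 4 * (2 * exp 1 / t) powr (1/4)\<close>. The constant is the integral over
  \<open>0 < t < 2\<close> of this bound times \<open>t powr (-1/2)\<close>.
\<close>

definition LlogL_const :: real where
  "LlogL_const = 4 * (2 * exp 1) powr (1/4) * (2 powr (1/4) / (1/4))"

lemma nn_integral_log_weight:
  "(\<integral>\<^sup>+t\<in>{0<..<2}. ennreal (4 * (2 * exp 1) powr (1/4) * t powr (-3/4)) \<partial>lborel) = ennreal LlogL_const"
  "LlogL_const \<ge> 0"
proof -
  have "((\<lambda>t. 4 * (2 * exp 1) powr (1/4) * t powr (-3/4)) has_integral LlogL_const) {0..2::real}"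
    unfolding LlogL_const_def
    using has_integral_mult_right[OF has_integral_powr_from_0[of "-3/4" 2], of "4 * (2 * exp 1) powr (1/4)"]
    by simp
  then have "((\<lambda>t. 4 * (2 * exp 1) powr (1/4) * t powr (-3/4)) has_integral LlogL_const) {0<..<2::real}"
    by (simp add: has_integral_Icc_iff_Ioo)
  note * = nn_integral_has_integral_lebesgue[OF _ this]
  show "(\<integral>\<^sup>+t\<in>{0<..<2}. ennreal (4 * (2 * exp 1) powr (1/4) * t powr (-3/4)) \<partial>lborel) = ennreal LlogL_const"
    using * by (simp add: mult.commute ennreal_mult'' ennreal_indicator)
  show "LlogL_const \<ge> 0"
    by (simp add: LlogL_const_def)
qed

text \<open>
  Chebyshev's inequality: \<open>L\<^sup>2\<close> embeds into weak \<open>L\<^sup>2\<close>.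
\<close>

lemma decreasing_rearrangement_le:
  assumes u: "u \<in> borel_measurable \<mu>" and B: "(\<integral>\<^sup>+x. ennreal ((cmod (u x))\<^sup>2) \<partial>\<mu>) \<le> ennreal (B\<^sup>2)" "B > 0"
    and t: "t > 0"
  shows "decreasing_rearrangement (abs_L0 u) t \<le> B / sqrt t"
proof -
  define s where "s = B / sqrt t"
  have s: "s > 0" using B t by (simp add: s_def)
  note [measurable] = u
  have "emeasure \<mu> {x \<in> space \<mu>. cmod (u x) > s}
      \<le> emeasure \<mu> {x \<in> space \<mu>. 1 \<le> ennreal (1 / s\<^sup>2) * ennreal ((cmod (u x))\<^sup>2)}"
  proof (rule emeasure_mono)
    show "{x \<in> space \<mu>. cmod (u x) > s} \<subseteq> {x \<in> space \<mu>. 1 \<le> ennreal (1 / s\<^sup>2) * ennreal ((cmod (u x))\<^sup>2)}"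
      using s by (auto simp: ennreal_mult'[symmetric] power_mono simp flip: ennreal_1)
  qed measurable
  also have "\<dots> \<le> ennreal (1 / s\<^sup>2) * (\<integral>\<^sup>+x. ennreal ((cmod (u x))\<^sup>2) * indicator (space \<mu>) x \<partial>\<mu>)"
    by (rule nn_integral_Markov_inequality) measurable
  also have "(\<integral>\<^sup>+x. ennreal ((cmod (u x))\<^sup>2) * indicator (space \<mu>) x \<partial>\<mu>) = (\<integral>\<^sup>+x. ennreal ((cmod (u x))\<^sup>2) \<partial>\<mu>)"
    by (rule nn_integral_cong) simp
  also have "ennreal (1 / s\<^sup>2) * \<dots> \<le> ennreal (1 / s\<^sup>2) * ennreal (B\<^sup>2)"
    using B(1) by (rule mult_left_mono) simp
  also have "\<dots> = ennreal t"
    using B(2) t by (simp add: s_def power_divide ennreal_mult'[symmetric])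
  finally have "measure \<mu> {x \<in> space \<mu>. cmod (u x) > s} \<le> t"
    using t by (simp add: measure_def enn2real_leI)
  then have "s \<in> {s. 0 \<le> s \<and> distribution_function (abs_L0 u) s \<le> t}"
    using s u by (simp add: distribution_function.abs_eq ae_eq_refl)
  then show ?thesis
    unfolding decreasing_rearrangement_def s_def[symmetric]
    by (intro cInf_lower) (auto intro: bdd_belowI[of _ 0])
qed

text \<open>
  \<open>L\<^sup>2\<close> embeds continuously into \<open>L log L\<close>.
\<close>

lemma enorm_LlogL_le:
  assumes u: "u \<in> borel_measurable \<mu>" and B: "(\<integral>\<^sup>+x. ennreal ((cmod (u x))\<^sup>2) \<partial>\<mu>) \<le> ennreal (B\<^sup>2)" "B > 0"
  shows "enorm_LlogL (abs_L0 u) \<le> ennreal (B * LlogL_const)"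
proof -
  have "enorm_LlogL (abs_L0 u) \<le>
     (\<integral>\<^sup>+t. ennreal B * (ennreal (4 * (2 * exp 1) powr (1/4) * t powr (-3/4)) * indicator {0<..<2} t) \<partial>lborel)"
    unfolding enorm_LlogL_def
  proof (rule nn_integral_mono)
    fix t :: real
    have "ennreal (decreasing_rearrangement (abs_L0 u) t * ln (2 * exp 1 / t)) \<le>
          ennreal B * ennreal (4 * (2 * exp 1) powr (1/4) * t powr (-3/4))" if t: "0 < t" "t < 2"
    proof -
      have "t < 2 * exp 1" using t exp_ge_add_one_self[of 1] by linarith
      then have "0 \<le> ln (2 * exp 1 / t)" using t by simp
      then have "decreasing_rearrangement (abs_L0 u) t * ln (2 * exp 1 / t) \<le> B / sqrt t * ln (2 * exp 1 / t)"
        by (intro mult_right_mono decreasing_rearrangement_le u B t)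
      also have "ln (2 * exp 1 / t) \<le> (2 * exp 1 / t) powr (1/4) / (1/4)"
        using \<open>t < 2 * exp 1\<close> t by (intro ln_powr_bound) auto
      then have "B / sqrt t * ln (2 * exp 1 / t) \<le> B / sqrt t * ((2 * exp 1 / t) powr (1/4) / (1/4))"
        using B t by (intro mult_left_mono) auto
      also have "\<dots> = B * (4 * (2 * exp 1) powr (1/4) * (t powr (-1/2) * t powr (-1/4)))"
        using t by (simp add: powr_divide powr_minus_divide powr_half_sqrt)
      also have "t powr (-1/2) * t powr (-1/4) = t powr (-3/4)"
        by (simp add: powr_add[symmetric])
      finally show ?thesis
        using B by (simp add: ennreal_mult'[symmetric] ennreal_leI)
    qed
    then show "ennreal (decreasing_rearrangement (abs_L0 u) t * ln (2 * exp 1 / t)) * indicator {0<..<2} t \<le>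
      ennreal B * (ennreal (4 * (2 * exp 1) powr (1/4) * t powr (-3/4)) * indicator {0<..<2} t)"
      by (auto simp: indicator_def)
  qed
  also have "\<dots> = ennreal B * ennreal LlogL_const"
    by (subst nn_integral_cmult) (simp_all only: nn_integral_log_weight(1), measurable)
  also have "\<dots> = ennreal (B * LlogL_const)"
    using B nn_integral_log_weight by (simp add: ennreal_mult')
  finally show ?thesis .
qed

lemma LlogL_fun_L0:
  assumes "continuous_on {-1..1} u" "integral {-1..1} (\<lambda>x. (u x)\<^sup>2) \<le> B\<^sup>2" "B > 0"
  shows "fun_L0 u \<in> LlogL" "norm_LlogL (fun_L0 u) \<le> B * LlogL_const"
proof -
  have "(\<integral>\<^sup>+x. ennreal ((cmod (complex_of_real (u x)))\<^sup>2) \<partial>\<mu>) = (\<integral>\<^sup>+x. ennreal ((u x)\<^sup>2) \<partial>\<mu>)"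
    by simp
  also have "\<dots> = ennreal (integral {-1..1} (\<lambda>x. (u x)\<^sup>2))"
    by (intro nn_integral_mu_continuous continuous_intros assms) auto
  also have "\<dots> \<le> ennreal (B\<^sup>2)"
    using assms by (intro ennreal_leI)
  finally have le: "(\<integral>\<^sup>+x. ennreal ((cmod (complex_of_real (u x)))\<^sup>2) \<partial>\<mu>) \<le> ennreal (B\<^sup>2)" .
  have "(\<lambda>x. complex_of_real (u x)) \<in> borel_measurable \<mu>"
    by (intro measurable_mu_continuous continuous_intros continuous_on_subset[OF assms(1)]) auto
  note * = enorm_LlogL_le[OF this le assms(3), folded fun_L0_def]
  show "fun_L0 u \<in> LlogL"
    using * by (auto simp: LlogL_def intro: le_less_trans)
  show "norm_LlogL (fun_L0 u) \<le> B * LlogL_const"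
    unfolding norm_LlogL_def using * assms(3) nn_integral_log_weight(2)
    by (intro enn2real_leI) auto
qed

section \<open>Weak convergence to zero\<close>

lemma cheb_sin_in_LlogL: "fun_L0 (cheb_sin (Suc n)) \<in> LlogL"
  using integral_cheb_sin_square_le[of "Suc n"]
  by (intro LlogL_fun_L0(1)[where B = "sqrt 2"] continuous_intros) (auto simp: power2_eq_square)

lemma zero_in_LlogL: "0 \<in> LlogL"
proof -
  have "fun_L0 (\<lambda>_. 0) \<in> LlogL"
    by (rule LlogL_fun_L0(1)[where B = 1]) auto
  then show ?thesis by (simp add: fun_L0_def zero_L0_def)
qed

lemma dual_zero:
  assumes "\<phi> \<in> continuous_dual scale_L0 LlogL norm_LlogL"
  shows "\<phi> 0 = 0"
proof -
  have "\<phi> (0 + 0) = \<phi> 0 + \<phi> 0"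
    using assms zero_in_LlogL unfolding continuous_dual_def by blast
  then show ?thesis by simp
qed

lemma sum_cheb_sin_in_LlogL:
  assumes "finite S" "S \<noteq> {}"
  shows "(\<Sum>k\<in>S. fun_L0 (cheb_sin (Suc k))) \<in> LlogL"
    and "norm_LlogL (\<Sum>k\<in>S. fun_L0 (cheb_sin (Suc k))) \<le> sqrt (2 * card S) * LlogL_const"
proof -
  let ?g = "\<lambda>x. \<Sum>k\<in>Suc ` S. cheb_sin k x"
  have inj: "inj_on Suc S" by simp
  have "(\<Sum>k\<in>S. fun_L0 (cheb_sin (Suc k))) = fun_L0 (\<lambda>x. \<Sum>k\<in>S. cheb_sin (Suc k) x)"
    using assms by (intro fun_L0_sum continuous_intros) auto
  also have "(\<lambda>x. \<Sum>k\<in>S. cheb_sin (Suc k) x) = ?g"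
    by (simp add: sum.reindex)
  finally have eq: "(\<Sum>k\<in>S. fun_L0 (cheb_sin (Suc k))) = fun_L0 ?g" .
  have le: "integral {-1..1} (\<lambda>x. (?g x)\<^sup>2) \<le> (sqrt (2 * card S))\<^sup>2"
    using integral_sum_cheb_sin_square_le[of "Suc ` S"] assms by (auto simp: card_image[OF inj])
  have pos: "sqrt (2 * card S) > 0"
    using assms by (simp add: card_gt_0_iff)
  have cont: "continuous_on {-1..1} ?g"
    by (intro continuous_intros) auto
  show "(\<Sum>k\<in>S. fun_L0 (cheb_sin (Suc k))) \<in> LlogL"
    and "norm_LlogL (\<Sum>k\<in>S. fun_L0 (cheb_sin (Suc k))) \<le> sqrt (2 * card S) * LlogL_const"
    unfolding eq by (rule LlogL_fun_L0[OF cont le pos])+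
qed

lemma dual_sum_cheb_sin:
  assumes \<phi>: "\<phi> \<in> continuous_dual scale_L0 LlogL norm_LlogL" and "finite S"
  shows "\<phi> (\<Sum>k\<in>S. fun_L0 (cheb_sin (Suc k))) = (\<Sum>k\<in>S. \<phi> (fun_L0 (cheb_sin (Suc k))))"
  using \<open>finite S\<close>
proof (induction rule: finite_induct)
  case empty
  then show ?case using dual_zero[OF \<phi>] by simp
next
  case (insert j S)
  have "(\<Sum>k\<in>S. fun_L0 (cheb_sin (Suc k))) \<in> LlogL"
    using sum_cheb_sin_in_LlogL(1)[of S] insert.hyps zero_in_LlogL by (cases "S = {}") auto
  then have "\<phi> (fun_L0 (cheb_sin (Suc j)) + (\<Sum>k\<in>S. fun_L0 (cheb_sin (Suc k)))) =
        \<phi> (fun_L0 (cheb_sin (Suc j))) + \<phi> (\<Sum>k\<in>S. fun_L0 (cheb_sin (Suc k)))"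
    using \<phi> cheb_sin_in_LlogL unfolding continuous_dual_def by blast
  then show ?case
    using insert by simp
qed

text \<open>
  If a functional had real part at least \<open>\<delta>\<close> on infinitely many of the functions, then its value on a
  sum of \<open>M\<close> of them would be at least \<open>M * \<delta>\<close>, while the norm of that sum grows only like \<open>sqrt M\<close>.
  All coefficients in the sum are \<open>1\<close>, because \<open>integral_sum_cheb_sin_square_le\<close> rests on the sign of
  the inner products; the factor \<open>c\<close> makes up for this by covering every direction in the plane.
\<close>

lemma finite_dual_large_Re:
  assumes \<phi>: "\<phi> \<in> continuous_dual scale_L0 LlogL norm_LlogL" and \<delta>: "\<delta> > 0"
  shows "finite {n. Re (c * \<phi> (fun_L0 (cheb_sin (Suc n)))) \<ge> \<delta>}" (is "finite ?I")
proof (rule ccontr)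
  assume inf: "infinite ?I"
  obtain C where C: "\<And>x. x \<in> LlogL \<Longrightarrow> cmod (\<phi> x) \<le> C * norm_LlogL x"
    using \<phi> unfolding continuous_dual_def by blast
  define A where "A = cmod c * \<bar>C\<bar> * sqrt 2 * LlogL_const"
  \<comment> \<open>With this \<open>M\<close> the lower bound \<open>M * \<delta>\<close> exceeds the upper bound \<open>A * sqrt M\<close>.\<close>
  obtain M :: nat where M: "real M > (A / \<delta>)\<^sup>2" by (meson reals_Archimedean2)
  then have "M > 0" by (metis gr0I of_nat_0 not_less zero_le_power2)
  obtain S where S: "S \<subseteq> ?I" "finite S" "card S = M"
    using infinite_arbitrarily_large[OF inf] by blast
  let ?g = "\<Sum>k\<in>S. fun_L0 (cheb_sin (Suc k))"
  have "S \<noteq> {}" using S \<open>M > 0\<close> by auto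
  then have g: "\<phi> ?g = (\<Sum>k\<in>S. \<phi> (fun_L0 (cheb_sin (Suc k))))" "?g \<in> LlogL"
      "norm_LlogL ?g \<le> sqrt (2 * M) * LlogL_const"
    using dual_sum_cheb_sin[OF \<phi> S(2)] sum_cheb_sin_in_LlogL[OF S(2)] S by auto
  have "M * \<delta> = (\<Sum>k\<in>S. \<delta>)" using S by simp
  also have "\<dots> \<le> (\<Sum>k\<in>S. Re (c * \<phi> (fun_L0 (cheb_sin (Suc k)))))"
    using S by (intro sum_mono) auto
  also have "\<dots> = Re (c * \<phi> ?g)"
    unfolding g(1) by (simp only: sum_distrib_left Re_sum)
  also have "\<dots> \<le> cmod c * cmod (\<phi> ?g)"
    using complex_Re_le_cmod[of "c * \<phi> ?g"] by (simp add: norm_mult)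
  also have "\<dots> \<le> cmod c * (\<bar>C\<bar> * (sqrt (2 * M) * LlogL_const))"
  proof (intro mult_left_mono)
    have "cmod (\<phi> ?g) \<le> C * norm_LlogL ?g" by (rule C[OF g(2)])
    also have "\<dots> \<le> \<bar>C\<bar> * norm_LlogL ?g"
      by (intro mult_right_mono) (auto simp: norm_LlogL_def)
    also have "\<dots> \<le> \<bar>C\<bar> * (sqrt (2 * M) * LlogL_const)"
      by (intro mult_left_mono g(3)) auto
    finally show "cmod (\<phi> ?g) \<le> \<bar>C\<bar> * (sqrt (2 * M) * LlogL_const)" .
  qed auto
  also have "\<dots> = A * sqrt M"
    by (simp add: A_def real_sqrt_mult)
  finally have "M * \<delta> \<le> A * sqrt M" .
  moreover have "M * \<delta> = sqrt M * (sqrt M * \<delta>)"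
    by (simp flip: mult.assoc)
  ultimately have "sqrt M * (sqrt M * \<delta>) \<le> sqrt M * A"
    by (simp only: mult.commute[of A])
  then have "sqrt M * \<delta> \<le> A"
    using \<open>M > 0\<close> by (simp only: mult_le_cancel_left_pos real_sqrt_gt_0_iff of_nat_0_less_iff)
  then have "sqrt M \<le> A / \<delta>"
    using \<delta> by (simp only: pos_le_divide_eq)
  then have "(sqrt M)\<^sup>2 \<le> (A / \<delta>)\<^sup>2"
    by (intro power_mono) auto
  then show False using M by simp
qed

lemma dual_cheb_sin_tendsto_0:
  assumes \<phi>: "\<phi> \<in> continuous_dual scale_L0 LlogL norm_LlogL"
  shows "(\<lambda>n. \<phi> (fun_L0 (cheb_sin (Suc n)))) \<longlonglongrightarrow> 0"
proof (rule tendstoI)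
  fix e :: real assume "e > 0"
  define z where "z n = \<phi> (fun_L0 (cheb_sin (Suc n)))" for n
  have ev: "eventually (\<lambda>n. Re (c * z n) < e / 2) sequentially" for c
  proof -
    have "finite {n. Re (c * z n) \<ge> e / 2}"
      unfolding z_def using \<open>e > 0\<close> by (intro finite_dual_large_Re[OF \<phi>]) simp
    then show ?thesis
      by (simp add: eventually_cofinite not_less flip: cofinite_eq_sequentially)
  qed
  from ev[of 1] ev[of "-1"] ev[of \<i>] ev[of "-\<i>"]
  show "eventually (\<lambda>n. dist (\<phi> (fun_L0 (cheb_sin (Suc n)))) 0 < e) sequentially"
    unfolding z_def[symmetric]
  proof eventually_elim
    case (elim n)
    then show ?case using cmod_le[of "z n"] by (simp add: abs_if split: if_splits)
  qed
qed

section \<open>Failure of complete continuity\<close>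

theorem theorem4p6:
  shows "\<not> completely_continuous scale_L0 LlogL norm_LlogL L1 norm_L1 T_log"
proof
  define f where "f n = fun_L0 (cheb_sin (Suc n))" for n
  have Tf: "T_log (f n) = fun_L0 (\<lambda>t. - cheb_cos (Suc n) t)" for n
    unfolding T_log_def f_def by (simp add: cheb_sin_in_LlogL finite_hilbert_transform_cheb_sin)
  have sep: "norm_L1 (T_log (f m) - T_log (f n)) \<ge> 2 / 3" if "m \<noteq> n" for m n
  proof -
    have "T_log (f m) - T_log (f n) = fun_L0 (\<lambda>t. - cheb_cos (Suc m) t - - cheb_cos (Suc n) t)"
      unfolding Tf by (intro fun_L0_diff continuous_intros) auto
    also have "norm_L1 \<dots> = integral {-1..1} (\<lambda>t. \<bar>- cheb_cos (Suc m) t - - cheb_cos (Suc n) t\<bar>)"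
      by (intro norm_L1_fun_L0 continuous_intros) auto
    also have "\<dots> \<ge> 2 / 3"
      using integral_abs_cheb_cos_diff_ge[of "Suc n" "Suc m"] that by simp
    finally show ?thesis .
  qed
  assume cc: "completely_continuous scale_L0 LlogL norm_LlogL L1 norm_L1 T_log"
  have "limitin (weak_topology scale_L0 LlogL norm_LlogL) f 0 sequentially"
    by (intro limitin_weak_topology)
       (simp_all add: f_def zero_in_LlogL cheb_sin_in_LlogL dual_zero dual_cheb_sin_tendsto_0)
  then have "compactin (weak_topology scale_L0 LlogL norm_LlogL) (insert 0 (range f))"
    by (rule compactin_weak_topology_sequence) (simp add: f_def cheb_sin_in_LlogL)
  with cc obtain C where C: "compactin (norm_topology L1 norm_L1) C" "T_log ` insert 0 (range f) \<subseteq> C"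
    unfolding completely_continuous_def by meson
  then have "\<And>n. T_log (f n) \<in> C" by blast
  from Metric_space.not_compactin_if_separated[OF Metric_space_L1 this _ sep] C(1)
  show False by (simp add: norm_topology_def)
qed

end
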